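(* Let $X$ be a completely regular topological space. Then $\mathbb{H}_b(X)$ is the Dedekind order completion of $C_b(X)$, that is, $C_b(X)^{\#}=\mathbb{H}_b(X)\subseteq\mathbb{H}_{ft}(X)$.
   Context: Let $\overline{\mathbb{R}}=\mathbb{R}\cup\{\pm\infty\}$ and let $\mathbb{I}\overline{\mathbb{R}}=\{[\underline a,\overline a]:\underline a,\overline a\in\overline{\mathbb{R}},\ \underline a\le\overline a\}$ be the set of closed intervals $[\underline a,\overline a]=\{z\in\overline{\mathbb R}:\underline a\le z\le\overline a\}$, partially ordered by $[\underline a,\overline a]\le[\underline b,\overline b]\iff \underline a\le\underline b$ and $\overline a\le\overline b$. A point $x\in\overline{\mathbb{R}}$ is identified with $[x,x]$. For a topological space $X$ let $\mathbb{A}(X)$ be the set of all functions $f:X\to\mathbb{I}\overline{\mathbb{R}}$, ordered pointwise: $f\le g\iff f(x)\le g(x)$ for all $x\in X$. Let $\mathcal{A}(X)\subset\mathbb{A}(X)$ be the set of functions $X\to\overline{\mathbb{R}}$. With $\mathcal{V}_x$ the set of neighborhoods of $x$, define for $f\in\mathbb{A}(X)$ the functions $I(f),S(f)\in\mathcal{A}(X)$ and $F(f)\in\mathbb{A}(X)$ by $I(f)(x)=\sup_{V\in\mathcal{V}_x}\inf\{z\in f(y):y\in V\}$, $S(f)(x)=\inf_{V\in\mathcal{V}_x}\sup\{z\in f(y):y\in V\}$, $F(f)(x)=[I(f)(x),S(f)(x)]$. A function $f\in\mathbb{A}(X)$ is Hausdorff continuous (H-continuous) if for every $g\in\mathbb{A}(X)$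 with $g(x)\subseteq f(x)$ for all $x\in X$ one has $F(g)(x)=f(x)$ for all $x\in X$. $\mathbb{H}(X)$ is the set of all H-continuous functions on $X$, and $\mathbb{H}_{ft}(X)=\{f\in\mathbb{H}(X): f(x)\subseteq\mathbb{R}\text{ for all }x\in X\}$. $\mathbb{H}_b(X)=\{f\in\mathbb{H}(X):\exists M\in\mathbb{R}:\ -M\le f(x)\le M,\ x\in X\}$ is the set of bounded H-continuous functions. $C_b(X)$ is the set of bounded continuous functions $X\to\mathbb{R}$; it is contained in $\mathbb{H}_b(X)$. All these sets carry the order induced from $\mathbb{A}(X)$. A partially ordered set $P$ is Dedekind order complete if every nonempty subset of $P$ bounded from above in $P$ has a supremum in $P$ and every nonempty subset of $P$ bounded from below in $P$ has an infimum in $P$. For a subset $P$ of a partially ordered set $Q$ (with the induced order), $Q$ is the Dedekind order completion $P^{\#}$ of $P$ if $Q$ is Dedekind order complete and every element of $Q$ is both the supremum in $Q$ of some subset of $P$ and the infimum in $Q$ of some subset of $P$. Completely regular means: for every $x\in X$ and every neighborhood $V$ of $x$ there is a continuous $\phi:X\to[0,1]$ with $\phi(x)=1$ and $\phi(y)=0$ for $y\notin V$. *)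

theory Defs
  imports "HOL-Analysis.Analysis" "HOL-Library.Interval" "HOL-Algebra.Order"
begin

section \<open>Extended real intervals\<close>

text \<open>The library type \<^typ>\<open>ereal interval\<close> is ordered by inclusion, so the
  componentwise order gets a name of its own. A point \<open>z\<close> is identified with
  \<open>interval_of z\<close>, and \<open>set_of a\<close> is the interval \<open>a\<close> as a set of points.\<close>

definition ivl_le :: "ereal interval \<Rightarrow> ereal interval \<Rightarrow> bool"
  where "ivl_le a b \<longleftrightarrow> lower a \<le> lower b \<and> upper a \<le> upper b"


section \<open>Interval valued functions on a topological space\<close>

text \<open>Functions on \<open>X\<close> are taken to be extensional on \<open>topspace X\<close>, so that
  functions agreeing on \<open>X\<close> are equal.\<close>

definition ivl_funs :: "'a topology \<Rightarrow> ('a \<Rightarrow> ereal interval) set"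
  where "ivl_funs X = (topspace X \<rightarrow>\<^sub>E UNIV)"

definition ivl_fun_le ::
    "'a topology \<Rightarrow> ('a \<Rightarrow> ereal interval) \<Rightarrow> ('a \<Rightarrow> ereal interval) \<Rightarrow> bool"
  where "ivl_fun_le X f g \<longleftrightarrow> (\<forall>x\<in>topspace X. ivl_le (f x) (g x))"

definition ivl_fun_poset ::
    "'a topology \<Rightarrow> ('a \<Rightarrow> ereal interval) set \<Rightarrow> ('a \<Rightarrow> ereal interval) gorder"
  where "ivl_fun_poset X P = \<lparr>carrier = P, eq = (=), le = ivl_fun_le X\<rparr>"

lemma partial_order_ivl_fun_poset:
  assumes "P \<subseteq> ivl_funs X"
  shows "partial_order (ivl_fun_poset X P)"
proof
  fix f g assume fg: "f \<in> carrier (ivl_fun_poset X P)" "g \<in> carrier (ivl_fun_poset X P)"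
    and le: "f \<sqsubseteq>\<^bsub>ivl_fun_poset X P\<^esub> g" "g \<sqsubseteq>\<^bsub>ivl_fun_poset X P\<^esub> f"
  have "f \<in> topspace X \<rightarrow>\<^sub>E UNIV" "g \<in> topspace X \<rightarrow>\<^sub>E UNIV"
    using fg assms by (auto simp: ivl_fun_poset_def ivl_funs_def)
  moreover have "f x = g x" if "x \<in> topspace X" for x
    using le that
    by (auto simp: ivl_fun_poset_def ivl_fun_le_def ivl_le_def interval_eq_iff intro: antisym)
  ultimately have "f = g" by (rule PiE_ext)
  then show "f .=\<^bsub>ivl_fun_poset X P\<^esub> g" by (simp add: ivl_fun_poset_def)
qed (auto simp: ivl_fun_poset_def ivl_fun_le_def ivl_le_def intro: order_trans)

definition nbhds_of :: "'a topology \<Rightarrow> 'a \<Rightarrow> 'a set set"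
  where "nbhds_of X x = {V. V \<subseteq> topspace X \<and> (\<exists>U. openin X U \<and> x \<in> U \<and> U \<subseteq> V)}"

definition lower_env :: "'a topology \<Rightarrow> ('a \<Rightarrow> ereal interval) \<Rightarrow> 'a \<Rightarrow> ereal"
  where "lower_env X f x = (SUP V\<in>nbhds_of X x. Inf (\<Union>y\<in>V. set_of (f y)))"

definition upper_env :: "'a topology \<Rightarrow> ('a \<Rightarrow> ereal interval) \<Rightarrow> 'a \<Rightarrow> ereal"
  where "upper_env X f x = (INF V\<in>nbhds_of X x. Sup (\<Union>y\<in>V. set_of (f y)))"

lemma lower_env_le_upper_env: "lower_env X f x \<le> upper_env X f x"
  unfolding lower_env_def upper_env_def
proof (intro SUP_least INF_greatest)
  fix V W assume "V \<in> nbhds_of X x" "W \<in> nbhds_of X x"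
  then have "x \<in> V" "x \<in> W" by (auto simp: nbhds_of_def)
  moreover have "lower (f x) \<in> set_of (f x)" by (simp add: set_of_eq)
  ultimately show "Inf (\<Union>y\<in>V. set_of (f y)) \<le> Sup (\<Union>y\<in>W. set_of (f y))"
    by (meson Inf_lower Sup_upper UN_I order_trans)
qed

definition graph_completion ::
    "'a topology \<Rightarrow> ('a \<Rightarrow> ereal interval) \<Rightarrow> 'a \<Rightarrow> ereal interval"
  where "graph_completion X f = (\<lambda>x\<in>topspace X. Interval (lower_env X f x, upper_env X f x))"

lemma lower_upper_graph_completion:
  assumes "x \<in> topspace X"
  shows "lower (graph_completion X f x) = lower_env X f x"
    and "upper (graph_completion X f x) = upper_env X f x"
  using assms lower_env_le_upper_env[of X f x]
  by (simp_all add: graph_completion_def lower.rep_eq upper.rep_eq Interval_inverse)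


section \<open>Hausdorff continuous functions\<close>

definition H_continuous :: "'a topology \<Rightarrow> ('a \<Rightarrow> ereal interval) \<Rightarrow> bool"
  where "H_continuous X f \<longleftrightarrow>
    f \<in> ivl_funs X \<and>
    (\<forall>g\<in>ivl_funs X. (\<forall>x\<in>topspace X. set_of (g x) \<subseteq> set_of (f x)) \<longrightarrow>
       (\<forall>x\<in>topspace X. graph_completion X g x = f x))"

definition H_funs :: "'a topology \<Rightarrow> ('a \<Rightarrow> ereal interval) set"
  where "H_funs X = {f. H_continuous X f}"

definition H_ft :: "'a topology \<Rightarrow> ('a \<Rightarrow> ereal interval) set"
  where "H_ft X = {f \<in> H_funs X. \<forall>x\<in>topspace X. set_of (f x) \<subseteq> range ereal}"

definition H_b :: "'a topology \<Rightarrow> ('a \<Rightarrow> ereal interval) set"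
  where "H_b X = {f \<in> H_funs X. \<exists>M::real. \<forall>x\<in>topspace X.
    ivl_le (interval_of (ereal (- M))) (f x) \<and> ivl_le (f x) (interval_of (ereal M))}"

definition C_b :: "'a topology \<Rightarrow> ('a \<Rightarrow> ereal interval) set"
  where "C_b X = {\<lambda>x\<in>topspace X. interval_of (ereal (\<phi> x)) |\<phi>.
    continuous_map X euclideanreal \<phi> \<and> bounded (\<phi> ` topspace X)}"


section \<open>Dedekind order completion\<close>

definition dedekind_complete :: "'a gorder \<Rightarrow> bool"
  where "dedekind_complete L \<longleftrightarrow>
    partial_order L \<and>
    (\<forall>A. A \<subseteq> carrier L \<and> A \<noteq> {} \<and> Upper L A \<noteq> {} \<longrightarrow> (\<exists>s. is_lub L s A)) \<and>
    (\<forall>A. A \<subseteq> carrier L \<and> A \<noteq> {} \<and> Lower L A \<noteq> {} \<longrightarrow> (\<exists>i. is_glb L i A))"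

definition dedekind_completion :: "'a set \<Rightarrow> 'a gorder \<Rightarrow> bool"
  where "dedekind_completion P Q \<longleftrightarrow>
    P \<subseteq> carrier Q \<and> dedekind_complete Q \<and>
    (\<forall>q\<in>carrier Q. (\<exists>A\<subseteq>P. is_lub Q q A) \<and> (\<exists>B\<subseteq>P. is_glb Q q B))"


section \<open>Complete regularity\<close>

text \<open>The library separates points from closed sets; neither formulation assumes
  any separation axiom on points.\<close>

lemma completely_regular_space_nbhds:
  "completely_regular_space X \<longleftrightarrow>
    (\<forall>x\<in>topspace X. \<forall>V\<in>nbhds_of X x. \<exists>\<phi>::'a \<Rightarrow> real.
       continuous_map X (top_of_set {0..1}) \<phi> \<and> \<phi> x = 1 \<and> (\<forall>y\<in>topspace X - V. \<phi> y = 0))"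
  (is "_ \<longleftrightarrow> ?R")
proof
  assume L: "completely_regular_space X"
  show ?R
  proof (intro ballI)
    fix x V assume "x \<in> topspace X" "V \<in> nbhds_of X x"
    then obtain U where U: "openin X U" "x \<in> U" "U \<subseteq> V" by (auto simp: nbhds_of_def)
    then have "closedin X (topspace X - U)" "x \<in> topspace X - (topspace X - U)"
      using \<open>x \<in> topspace X\<close> by auto
    then obtain f :: "'a \<Rightarrow> real" where f: "continuous_map X (top_of_set {0..1}) f"
      "f x = 0" "f ` (topspace X - U) \<subseteq> {1}"
      using L unfolding completely_regular_space_def by blast
    have "continuous_map X (top_of_set {0..1}) (\<lambda>y. 1 - f y)"
      using f(1) by (auto simp: continuous_map_in_subtopology image_subset_iff Pi_iff
          intro!: continuous_intros)
    then show "\<exists>\<phi>::'a \<Rightarrow> real. continuous_map X (top_of_set {0..1}) \<phi> \<and> \<phi> x = 1 \<and>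
        (\<forall>y\<in>topspace X - V. \<phi> y = 0)"
      using f U by (intro exI[of _ "\<lambda>y. 1 - f y"]) auto
  qed
next
  assume R: ?R
  show "completely_regular_space X"
    unfolding completely_regular_space_def
  proof (intro allI impI)
    fix S x assume S: "closedin X S \<and> x \<in> topspace X - S"
    then have "topspace X - S \<in> nbhds_of X x" by (auto simp: nbhds_of_def)
    then obtain \<phi> :: "'a \<Rightarrow> real" where \<phi>: "continuous_map X (top_of_set {0..1}) \<phi>"
      "\<phi> x = 1" "\<forall>y\<in>topspace X - (topspace X - S). \<phi> y = 0"
      using R S by blast
    have "continuous_map X (top_of_set {0..1}) (\<lambda>y. 1 - \<phi> y)"
      using \<phi>(1) by (auto simp: continuous_map_in_subtopology image_subset_iff Pi_iff
          intro!: continuous_intros)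
    moreover have "S \<subseteq> topspace X" using S closedin_subset by blast
    ultimately show "\<exists>f::'a \<Rightarrow> real. continuous_map X (top_of_set {0..1}) f \<and> f x = 0 \<and> f ` S \<subseteq> {1}"
      using \<phi> by (intro exI[of _ "\<lambda>y. 1 - \<phi> y"]) auto
  qed
qed

end

theory Submission
  imports Defs
begin

text \<open>
  Write an interval valued function as a pair \<open>(a, b)\<close> of its lower and upper bound, and let
  \<open>I\<close> and \<open>S\<close> be the lower and upper semicontinuous hull of an extended real function.
  Hausdorff continuity says that \<open>a = I b\<close> and \<open>b = S a\<close> (\<open>H_continuous_iff\<close>): the extreme
  selections \<open>a\<close> and \<open>b\<close> already force \<open>F g = f\<close> for every \<open>g\<close> in between, by monotonicity.
  So each bound determines the other monotonically, and the order on H-continuous functions can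
  be tested on the lower bounds alone or on the upper bounds alone (\<open>ivl_fun_le_iff_lower\<close>,
  \<open>ivl_fun_le_iff_upper\<close>).

  \<^emph>\<open>Completeness.\<close> The pointwise supremum \<open>s\<close> of the lower bounds of a family satisfies
  \<open>s \<le> I s\<close>, and for such an \<open>s\<close> the pair \<open>(I (S s), S s)\<close> is H-continuous, because
  \<open>S (I (S s)) = S s\<close>. It is the supremum of the family (\<open>H_funs_supremum\<close>). If the family is
  nonempty and bounded above in \<open>H_b\<close>, its supremum is squeezed between bounded functions.
  Infima are suprema of sets of lower bounds.

  \<^emph>\<open>Density.\<close> The lower bound of an H-continuous function is lower semicontinuous, so on a
  completely regular space a bounded one is the pointwise supremum of the bounded continuous
  functions below it (\<open>continuous_minorant\<close>): a Urysohn function lifts the constant lower bound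
  almost to the required value at a point. As the order only depends on lower bounds, this
  pointwise supremum is also the supremum in \<open>H_b\<close>. Negation gives the statement for infima.
\<close>

section \<open>Semicontinuous hulls\<close>

definition lsc_hull :: "'a topology \<Rightarrow> ('a \<Rightarrow> ereal) \<Rightarrow> 'a \<Rightarrow> ereal"
  where "lsc_hull X u x = (SUP V\<in>nbhds_of X x. INF y\<in>V. u y)"

definition usc_hull :: "'a topology \<Rightarrow> ('a \<Rightarrow> ereal) \<Rightarrow> 'a \<Rightarrow> ereal"
  where "usc_hull X u x = (INF V\<in>nbhds_of X x. SUP y\<in>V. u y)"

lemma usc_hull_eq_uminus: "usc_hull X u x = - lsc_hull X (\<lambda>y. - u y) x"
  unfolding usc_hull_def lsc_hull_def
  by (simp add: ereal_INF_uminus_eq ereal_SUP_uminus_eq)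

lemma lsc_hull_uminus: "lsc_hull X (\<lambda>y. - u y) x = - usc_hull X u x"
  by (simp add: usc_hull_eq_uminus)

lemma lsc_hull_mono:
  assumes "\<And>y. y \<in> topspace X \<Longrightarrow> u y \<le> v y"
  shows "lsc_hull X u x \<le> lsc_hull X v x"
  unfolding lsc_hull_def using assms
  by (intro SUP_mono' SUP_subset_mono INF_mono order_refl) (auto simp: nbhds_of_def)

lemma lsc_hull_cong:
  assumes "\<And>y. y \<in> topspace X \<Longrightarrow> u y = v y"
  shows "lsc_hull X u x = lsc_hull X v x"
  using assms by (intro antisym lsc_hull_mono) auto

lemma lsc_hull_le: "lsc_hull X u x \<le> u x"
  unfolding lsc_hull_def by (intro SUP_least INF_lower) (auto simp: nbhds_of_def)

lemma lsc_hull_idem: "lsc_hull X (lsc_hull X u) x = lsc_hull X u x"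
proof (rule antisym[OF lsc_hull_le])
  show "lsc_hull X u x \<le> lsc_hull X (lsc_hull X u) x"
    unfolding lsc_hull_def[of X u x]
  proof (rule SUP_least)
    fix V assume "V \<in> nbhds_of X x"
    then obtain U where U: "openin X U" "x \<in> U" "U \<subseteq> V" by (auto simp: nbhds_of_def)
    have nb: "U \<in> nbhds_of X y" if "y \<in> U" for y
      using U that openin_subset by (auto simp: nbhds_of_def)
    have "(INF y\<in>V. u y) \<le> (INF y\<in>U. u y)" using U by (intro INF_superset_mono) auto
    also have "\<dots> \<le> (INF y\<in>U. lsc_hull X u y)"
      unfolding lsc_hull_def by (intro INF_greatest SUP_upper nb)
    also have "\<dots> \<le> lsc_hull X (lsc_hull X u) x"
      unfolding lsc_hull_def[of X "lsc_hull X u"] using nb U by (intro SUP_upper) auto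
    finally show "(INF y\<in>V. u y) \<le> lsc_hull X (lsc_hull X u) x" .
  qed
qed

lemma usc_hull_mono:
  assumes "\<And>y. y \<in> topspace X \<Longrightarrow> u y \<le> v y"
  shows "usc_hull X u x \<le> usc_hull X v x"
  using assms by (simp add: usc_hull_eq_uminus lsc_hull_mono)

lemma usc_hull_cong:
  assumes "\<And>y. y \<in> topspace X \<Longrightarrow> u y = v y"
  shows "usc_hull X u x = usc_hull X v x"
  using assms by (intro antisym usc_hull_mono) auto

lemma usc_hull_ge: "u x \<le> usc_hull X u x"
  using lsc_hull_le[of X "\<lambda>y. - u y" x]
    ereal_minus_le_minus[of "- u x" "lsc_hull X (\<lambda>y. - u y) x"]
  by (simp add: usc_hull_eq_uminus)

lemma usc_hull_idem: "usc_hull X (usc_hull X u) x = usc_hull X u x"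
  by (simp add: usc_hull_eq_uminus lsc_hull_idem)

lemma lsc_hull_continuous:
  assumes "continuous_map X euclideanreal \<phi>" "x \<in> topspace X"
  shows "lsc_hull X (\<lambda>y. ereal (\<phi> y)) x = ereal (\<phi> x)"
proof (rule antisym[OF lsc_hull_le])
  show "ereal (\<phi> x) \<le> lsc_hull X (\<lambda>y. ereal (\<phi> y)) x"
  proof (rule ereal_le_epsilon2)
    fix e :: real assume "0 < e"
    define U where "U = {y \<in> topspace X. \<phi> y \<in> {\<phi> x - e<..}}"
    have "openin X U"
      unfolding U_def using assms(1) by (rule openin_continuous_map_preimage) auto
    then have "U \<in> nbhds_of X x"
      using assms(2) \<open>0 < e\<close> by (auto simp: nbhds_of_def U_def)
    moreover have "ereal (\<phi> x - e) \<le> (INF y\<in>U. ereal (\<phi> y))"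
      by (intro INF_greatest) (auto simp: U_def)
    ultimately have "ereal (\<phi> x - e) \<le> lsc_hull X (\<lambda>y. ereal (\<phi> y)) x"
      unfolding lsc_hull_def by (rule SUP_upper2)
    then show "ereal (\<phi> x) \<le> lsc_hull X (\<lambda>y. ereal (\<phi> y)) x + ereal e"
      by (cases "lsc_hull X (\<lambda>y. ereal (\<phi> y)) x") auto
  qed
qed

lemma usc_hull_continuous:
  assumes "continuous_map X euclideanreal \<phi>" "x \<in> topspace X"
  shows "usc_hull X (\<lambda>y. ereal (\<phi> y)) x = ereal (\<phi> x)"
  using lsc_hull_continuous[of X "\<lambda>y. - \<phi> y" x] assms by (simp add: usc_hull_eq_uminus)

text \<open>The values near \<open>x\<close> exceed \<open>r\<close>, so a Urysohn function supported near \<open>x\<close> can lift the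
  constant \<open>m\<close> to \<open>r\<close> there. The maximum only covers the case \<open>r < m\<close>.\<close>

lemma continuous_minorant:
  fixes m r :: real
  assumes X: "completely_regular_space X" and x: "x \<in> topspace X"
    and m: "\<forall>y\<in>topspace X. ereal m \<le> u y"
    and r: "ereal r < lsc_hull X u x"
  obtains \<phi> where "continuous_map X euclideanreal \<phi>" "bounded (\<phi> ` topspace X)"
    "r \<le> \<phi> x" "\<forall>y\<in>topspace X. ereal (\<phi> y) \<le> u y"
proof -
  obtain V where V: "V \<in> nbhds_of X x" "ereal r < (INF y\<in>V. u y)"
    using r by (auto simp: lsc_hull_def less_SUP_iff)
  obtain \<psi> :: "'a \<Rightarrow> real" where \<psi>: "continuous_map X (top_of_set {0..1}) \<psi>" "\<psi> x = 1"
    "\<forall>y\<in>topspace X - V. \<psi> y = 0"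
    using X[unfolded completely_regular_space_nbhds, rule_format, OF x V(1)] by auto
  have cont: "continuous_map X euclideanreal \<psi>"
    and unit: "\<And>y. y \<in> topspace X \<Longrightarrow> 0 \<le> \<psi> y \<and> \<psi> y \<le> 1"
    using \<psi>(1) by (auto simp: continuous_map_in_subtopology image_subset_iff Pi_iff)
  define d where "d = max r m - m"
  define \<phi> where "\<phi> = (\<lambda>y. m + d * \<psi> y)"
  have d: "0 \<le> d" "r \<le> m + d" by (auto simp: d_def)
  have range: "m \<le> \<phi> y \<and> \<phi> y \<le> m + d" if "y \<in> topspace X" for y
    using unit[OF that] d(1) mult_left_mono[of "\<psi> y" 1 d] by (auto simp: \<phi>_def)
  have "continuous_map X euclideanreal \<phi>"
    unfolding \<phi>_def by (intro continuous_intros cont)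
  moreover have "bounded (\<phi> ` topspace X)"
    using range by (intro bounded_subset[OF bounded_closed_interval[of m "m + d"]]) auto
  moreover have "r \<le> \<phi> x" using d by (simp add: \<phi>_def \<psi>(2))
  moreover have "ereal (\<phi> y) \<le> u y" if y: "y \<in> topspace X" for y
  proof (cases "y \<in> V")
    case True
    have "ereal r \<le> u y" using V(2) INF_lower[OF True, of u] by (simp add: less_imp_le order_trans)
    then have "ereal (m + d) \<le> u y" using bspec[OF m y] by (auto simp: d_def max_def)
    then show ?thesis using range[OF y] by (meson ereal_less_eq(3) order_trans)
  next
    case False
    then show ?thesis using \<psi>(3) y bspec[OF m y] by (simp add: \<phi>_def)
  qed
  ultimately show thesis using that by blast
qed

section \<open>H-continuous functions as pairs of mutual hulls\<close>

lemma set_of_subset_iff: "set_of a \<subseteq> set_of b \<longleftrightarrow> lower b \<le> lower a \<and> upper a \<le> upper b"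
  for a b :: "'a::linorder interval"
  by (auto simp: set_of_eq)

lemma lower_env_eq: "lower_env X f x = lsc_hull X (\<lambda>y. lower (f y)) x"
proof -
  have "Inf (\<Union>y\<in>V. set_of (f y)) = (INF y\<in>V. lower (f y))" for V
  proof (rule antisym)
    show "Inf (\<Union>y\<in>V. set_of (f y)) \<le> (INF y\<in>V. lower (f y))"
      by (intro INF_greatest Inf_lower) (auto simp: set_of_eq)
    show "(INF y\<in>V. lower (f y)) \<le> Inf (\<Union>y\<in>V. set_of (f y))"
      by (rule Inf_greatest) (auto simp: set_of_eq intro: INF_lower2)
  qed
  then show ?thesis by (simp add: lower_env_def lsc_hull_def)
qed

lemma upper_env_eq: "upper_env X f x = usc_hull X (\<lambda>y. upper (f y)) x"
proof -
  have "Sup (\<Union>y\<in>V. set_of (f y)) = (SUP y\<in>V. upper (f y))" for V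
  proof (rule antisym)
    show "(SUP y\<in>V. upper (f y)) \<le> Sup (\<Union>y\<in>V. set_of (f y))"
      by (intro SUP_least Sup_upper) (auto simp: set_of_eq intro: lower_le_upper)
    show "Sup (\<Union>y\<in>V. set_of (f y)) \<le> (SUP y\<in>V. upper (f y))"
      by (rule Sup_least) (auto simp: set_of_eq intro: SUP_upper2)
  qed
  then show ?thesis by (simp add: upper_env_def usc_hull_def)
qed

lemma graph_completion_eq_iff:
  assumes "x \<in> topspace X"
  shows "graph_completion X g x = i \<longleftrightarrow>
    lsc_hull X (\<lambda>y. lower (g y)) x = lower i \<and> usc_hull X (\<lambda>y. upper (g y)) x = upper i"
  using assms
  by (simp add: interval_eq_iff lower_upper_graph_completion lower_env_eq upper_env_eq)

text \<open>The two equations are what the selections \<open>y \<mapsto> upper (f y)\<close> and \<open>y \<mapsto> lower (f y)\<close>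
  contribute to the definition. Conversely they make both bounds fixed points of the hulls, so
  that the hulls of any \<open>g\<close> inside \<open>f\<close> are squeezed.\<close>

lemma H_continuous_iff:
  "H_continuous X f \<longleftrightarrow> f \<in> ivl_funs X \<and>
    (\<forall>x\<in>topspace X. lower (f x) = lsc_hull X (\<lambda>y. upper (f y)) x \<and>
                    upper (f x) = usc_hull X (\<lambda>y. lower (f y)) x)"
  (is "_ \<longleftrightarrow> _ \<and> ?R")
proof (intro iffI conjI)
  assume H: "H_continuous X f"
  then show "f \<in> ivl_funs X" by (simp add: H_continuous_def)
  have selection: "lsc_hull X s x = lower (f x) \<and> usc_hull X s x = upper (f x)"
    if "x \<in> topspace X" and s: "\<And>y. lower (f y) \<le> s y \<and> s y \<le> upper (f y)" for s x
  proof -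
    let ?g = "\<lambda>x\<in>topspace X. interval_of (s x)"
    have "?g \<in> ivl_funs X" by (simp add: ivl_funs_def)
    moreover have "\<forall>x\<in>topspace X. set_of (?g x) \<subseteq> set_of (f x)"
      using s by (simp add: set_of_subset_iff)
    ultimately have "graph_completion X ?g x = f x"
      using H that(1) unfolding H_continuous_def by blast
    then have "lsc_hull X (\<lambda>y. lower (?g y)) x = lower (f x)"
      "usc_hull X (\<lambda>y. upper (?g y)) x = upper (f x)"
      using that(1) by (simp_all add: graph_completion_eq_iff)
    moreover have "lsc_hull X (\<lambda>y. lower (?g y)) x = lsc_hull X s x"
      by (rule lsc_hull_cong) simp
    moreover have "usc_hull X (\<lambda>y. upper (?g y)) x = usc_hull X s x"
      by (rule usc_hull_cong) simp
    ultimately show ?thesis by simp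
  qed
  show ?R using selection by simp
next
  assume "f \<in> ivl_funs X \<and> ?R"
  then have f: "f \<in> ivl_funs X"
    and l: "\<And>x. x \<in> topspace X \<Longrightarrow> lower (f x) = lsc_hull X (\<lambda>y. upper (f y)) x"
    and u: "\<And>x. x \<in> topspace X \<Longrightarrow> upper (f x) = usc_hull X (\<lambda>y. lower (f y)) x"
    by auto
  show "H_continuous X f"
    unfolding H_continuous_def
  proof (intro conjI ballI impI f)
    fix g x assume sub: "\<forall>x\<in>topspace X. set_of (g x) \<subseteq> set_of (f x)" and x: "x \<in> topspace X"
    have g: "lower (f y) \<le> lower (g y)" "lower (g y) \<le> upper (g y)" "upper (g y) \<le> upper (f y)"
      if "y \<in> topspace X" for y
      using sub that by (auto simp: set_of_subset_iff)
    have "lsc_hull X (\<lambda>y. lower (g y)) x = lower (f x)"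
    proof (rule antisym)
      have "lower (g y) \<le> upper (f y)" if "y \<in> topspace X" for y
        using g[OF that] by order
      then show "lsc_hull X (\<lambda>y. lower (g y)) x \<le> lower (f x)"
        unfolding l[OF x] by (rule lsc_hull_mono)
      have "lower (f x) = lsc_hull X (lsc_hull X (\<lambda>y. upper (f y))) x"
        by (simp add: l x lsc_hull_idem)
      also have "\<dots> = lsc_hull X (\<lambda>y. lower (f y)) x"
        by (rule lsc_hull_cong) (simp add: l)
      also have "\<dots> \<le> lsc_hull X (\<lambda>y. lower (g y)) x"
        by (intro lsc_hull_mono g)
      finally show "lower (f x) \<le> lsc_hull X (\<lambda>y. lower (g y)) x" .
    qed
    moreover have "usc_hull X (\<lambda>y. upper (g y)) x = upper (f x)"
    proof (rule antisym)
      have "lower (f y) \<le> upper (g y)" if "y \<in> topspace X" for y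
        using g[OF that] by order
      then show "upper (f x) \<le> usc_hull X (\<lambda>y. upper (g y)) x"
        unfolding u[OF x] by (rule usc_hull_mono)
      have "usc_hull X (\<lambda>y. upper (g y)) x \<le> usc_hull X (\<lambda>y. upper (f y)) x"
        by (intro usc_hull_mono g)
      also have "\<dots> = usc_hull X (usc_hull X (\<lambda>y. lower (f y))) x"
        by (rule usc_hull_cong) (simp add: u)
      also have "\<dots> = upper (f x)"
        by (simp add: u x usc_hull_idem)
      finally show "usc_hull X (\<lambda>y. upper (g y)) x \<le> upper (f x)" .
    qed
    ultimately show "graph_completion X g x = f x"
      using x by (simp add: graph_completion_eq_iff)
  qed
qed

lemma H_funs_lower:
  "f \<in> H_funs X \<Longrightarrow> x \<in> topspace X \<Longrightarrow> lower (f x) = lsc_hull X (\<lambda>y. upper (f y)) x"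
  by (simp add: H_funs_def H_continuous_iff)

lemma H_funs_upper:
  "f \<in> H_funs X \<Longrightarrow> x \<in> topspace X \<Longrightarrow> upper (f x) = usc_hull X (\<lambda>y. lower (f y)) x"
  by (simp add: H_funs_def H_continuous_iff)

lemma H_funs_lower_lsc:
  assumes f: "f \<in> H_funs X" and x: "x \<in> topspace X"
  shows "lsc_hull X (\<lambda>y. lower (f y)) x = lower (f x)"
proof -
  have "lsc_hull X (\<lambda>y. lower (f y)) x = lsc_hull X (lsc_hull X (\<lambda>y. upper (f y))) x"
    using f by (intro lsc_hull_cong H_funs_lower)
  then show ?thesis by (simp add: H_funs_lower[OF f x] lsc_hull_idem)
qed

lemma H_funs_upper_usc:
  assumes f: "f \<in> H_funs X" and x: "x \<in> topspace X"
  shows "usc_hull X (\<lambda>y. upper (f y)) x = upper (f x)"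
proof -
  have "usc_hull X (\<lambda>y. upper (f y)) x = usc_hull X (usc_hull X (\<lambda>y. lower (f y))) x"
    using f by (intro usc_hull_cong H_funs_upper)
  then show ?thesis by (simp add: H_funs_upper[OF f x] usc_hull_idem)
qed

lemma ivl_fun_le_iff_lower:
  assumes "f \<in> H_funs X" "g \<in> H_funs X"
  shows "ivl_fun_le X f g \<longleftrightarrow> (\<forall>x\<in>topspace X. lower (f x) \<le> lower (g x))"
  using assms by (auto simp: ivl_fun_le_def ivl_le_def H_funs_upper intro: usc_hull_mono)

lemma ivl_fun_le_iff_upper:
  assumes "f \<in> H_funs X" "g \<in> H_funs X"
  shows "ivl_fun_le X f g \<longleftrightarrow> (\<forall>x\<in>topspace X. upper (f x) \<le> upper (g x))"
  using assms by (auto simp: ivl_fun_le_def ivl_le_def H_funs_lower intro: lsc_hull_mono)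

text \<open>The inequalities \<open>s \<le> I s \<le> I (S s)\<close> give \<open>S s \<le> S (I (S s))\<close>; the other direction
  \<open>S (I (S s)) \<le> S (S s) = S s\<close> always holds. So \<open>(I (S s), S s)\<close> is a pair of mutual hulls.\<close>

lemma H_funs_regularization:
  assumes s: "\<And>x. x \<in> topspace X \<Longrightarrow> s x \<le> lsc_hull X s x"
  obtains h where "h \<in> H_funs X"
    "\<forall>x\<in>topspace X. upper (h x) = usc_hull X s x"
    "\<forall>x\<in>topspace X. s x \<le> lower (h x)"
proof -
  define h where
    "h = (\<lambda>x\<in>topspace X. Interval (lsc_hull X (usc_hull X s) x, usc_hull X s x))"
  have l: "lower (h x) = lsc_hull X (usc_hull X s) x"
    and u: "upper (h x) = usc_hull X s x" if "x \<in> topspace X" for x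
    using that lsc_hull_le[of X "usc_hull X s" x]
    by (simp_all add: h_def lower.rep_eq upper.rep_eq Interval_inverse)
  have below: "s x \<le> lower (h x)" if "x \<in> topspace X" for x
  proof -
    have "s x \<le> lsc_hull X s x" by (rule s[OF that])
    also have "\<dots> \<le> lsc_hull X (usc_hull X s) x" by (intro lsc_hull_mono usc_hull_ge)
    finally show ?thesis by (simp add: l that)
  qed
  have "usc_hull X (\<lambda>y. lower (h y)) x = usc_hull X s x" for x
  proof (rule antisym)
    have "usc_hull X (\<lambda>y. lower (h y)) x \<le> usc_hull X (usc_hull X s) x"
      by (rule usc_hull_mono) (simp add: l lsc_hull_le)
    then show "usc_hull X (\<lambda>y. lower (h y)) x \<le> usc_hull X s x"
      by (simp add: usc_hull_idem)
    show "usc_hull X s x \<le> usc_hull X (\<lambda>y. lower (h y)) x"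
      using below by (rule usc_hull_mono)
  qed
  moreover have "lsc_hull X (\<lambda>y. upper (h y)) x = lsc_hull X (usc_hull X s) x" for x
    using u by (rule lsc_hull_cong)
  ultimately have "h \<in> H_funs X"
    by (simp add: H_funs_def H_continuous_iff l u) (simp add: h_def ivl_funs_def)
  then show thesis using u below that by blast
qed

lemma H_funs_supremum:
  assumes A: "A \<subseteq> H_funs X"
  obtains h where "h \<in> H_funs X" "\<And>f. f \<in> A \<Longrightarrow> ivl_fun_le X f h"
    "\<And>g. g \<in> H_funs X \<Longrightarrow> (\<And>f. f \<in> A \<Longrightarrow> ivl_fun_le X f g) \<Longrightarrow> ivl_fun_le X h g"
proof -
  define s where "s = (\<lambda>x. SUP f\<in>A. lower (f x))"
  have "s x \<le> lsc_hull X s x" if x: "x \<in> topspace X" for x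
    unfolding s_def
  proof (rule SUP_least)
    fix f assume f: "f \<in> A"
    have "lower (f x) = lsc_hull X (\<lambda>y. lower (f y)) x"
      using f A x by (auto simp: H_funs_lower_lsc)
    also have "\<dots> \<le> lsc_hull X (\<lambda>x. SUP f\<in>A. lower (f x)) x"
      using f by (intro lsc_hull_mono SUP_upper)
    finally show "lower (f x) \<le> lsc_hull X (\<lambda>x. SUP f\<in>A. lower (f x)) x" .
  qed
  then obtain h where h: "h \<in> H_funs X"
    "\<forall>x\<in>topspace X. upper (h x) = usc_hull X s x"
    "\<forall>x\<in>topspace X. s x \<le> lower (h x)"
    by (rule H_funs_regularization)
  have "ivl_fun_le X f h" if f: "f \<in> A" for f
  proof -
    have "lower (f x) \<le> lower (h x)" if "x \<in> topspace X" for x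
      using bspec[OF h(3) that] SUP_upper[OF f, of "\<lambda>f. lower (f x)"] by (simp add: s_def)
    then show ?thesis using f A h(1) by (auto simp: ivl_fun_le_iff_lower)
  qed
  moreover have "ivl_fun_le X h g"
    if g: "g \<in> H_funs X" and ub: "\<And>f. f \<in> A \<Longrightarrow> ivl_fun_le X f g" for g
  proof -
    have "s y \<le> lower (g y)" if "y \<in> topspace X" for y
      unfolding s_def using ub that
      by (intro SUP_least) (auto simp: ivl_fun_le_def ivl_le_def)
    then have "upper (h x) \<le> upper (g x)" if "x \<in> topspace X" for x
      using that g by (auto simp: h(2) H_funs_upper intro: usc_hull_mono)
    then show ?thesis using h(1) g by (simp add: ivl_fun_le_iff_upper)
  qed
  ultimately show thesis using h(1) that by blast
qed

section \<open>Bounded H-continuous functions\<close>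

lemma H_b_subset_H_funs: "H_b X \<subseteq> H_funs X"
  by (auto simp: H_b_def)

lemma H_b_iff:
  "f \<in> H_b X \<longleftrightarrow> f \<in> H_funs X \<and>
    (\<exists>M::real. \<forall>x\<in>topspace X. ereal (- M) \<le> lower (f x) \<and> upper (f x) \<le> ereal M)"
proof -
  have "ivl_le (interval_of (ereal (- M))) a \<and> ivl_le a (interval_of (ereal M)) \<longleftrightarrow>
      ereal (- M) \<le> lower a \<and> upper a \<le> ereal M" for M a
    using lower_le_upper[of a] by (auto simp: ivl_le_def simp del: lower_le_upper)
  then show ?thesis by (simp add: H_b_def)
qed

lemma H_b_between:
  assumes f: "f \<in> H_b X" and g: "g \<in> H_b X" and h: "h \<in> H_funs X"
    and le: "ivl_fun_le X f h" "ivl_fun_le X h g"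
  shows "h \<in> H_b X"
proof -
  obtain M N :: real where
    M: "\<And>x. x \<in> topspace X \<Longrightarrow> ereal (- M) \<le> lower (f x)" and
    N: "\<And>x. x \<in> topspace X \<Longrightarrow> upper (g x) \<le> ereal N"
    using f g by (auto simp: H_b_iff)
  have "ereal (- max M N) \<le> lower (h x) \<and> upper (h x) \<le> ereal (max M N)"
    if x: "x \<in> topspace X" for x
  proof
    have "ereal (- max M N) \<le> ereal (- M)" by simp
    also have "\<dots> \<le> lower (f x)" by (rule M[OF x])
    also have "\<dots> \<le> lower (h x)" using le(1) x by (auto simp: ivl_fun_le_def ivl_le_def)
    finally show "ereal (- max M N) \<le> lower (h x)" .
    have "upper (h x) \<le> upper (g x)" using le(2) x by (auto simp: ivl_fun_le_def ivl_le_def)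
    also have "\<dots> \<le> ereal N" by (rule N[OF x])
    also have "\<dots> \<le> ereal (max M N)" by simp
    finally show "upper (h x) \<le> ereal (max M N)" .
  qed
  then show ?thesis using h unfolding H_b_iff by blast
qed

lemma H_b_subset_H_ft: "H_b X \<subseteq> H_ft X"
proof
  fix f assume f: "f \<in> H_b X"
  then obtain M :: real where
    M: "\<And>x. x \<in> topspace X \<Longrightarrow> ereal (- M) \<le> lower (f x) \<and> upper (f x) \<le> ereal M"
    by (auto simp: H_b_iff)
  have "z \<in> range ereal" if "x \<in> topspace X" "z \<in> set_of (f x)" for x z
  proof -
    have "ereal (- M) \<le> z" "z \<le> ereal M"
      using M[OF that(1)] that(2) by (auto simp: set_of_eq intro: order_trans)
    then show ?thesis by (cases z) auto
  qed
  then show "f \<in> H_ft X" using f by (auto simp: H_ft_def H_b_def)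
qed

lemma C_bI:
  assumes "continuous_map X euclideanreal \<phi>" "bounded (\<phi> ` topspace X)"
  shows "(\<lambda>x\<in>topspace X. interval_of (ereal (\<phi> x))) \<in> C_b X"
  using assms by (auto simp: C_b_def)

lemma C_b_subset_H_b: "C_b X \<subseteq> H_b X"
proof
  fix f assume "f \<in> C_b X"
  then obtain \<phi> where f: "f = (\<lambda>x\<in>topspace X. interval_of (ereal (\<phi> x)))"
    and \<phi>: "continuous_map X euclideanreal \<phi>" "bounded (\<phi> ` topspace X)"
    by (auto simp: C_b_def)
  obtain M where "\<And>x. x \<in> topspace X \<Longrightarrow> \<bar>\<phi> x\<bar> \<le> M"
    using \<phi>(2) by (auto simp: bounded_iff)
  then have "\<forall>x\<in>topspace X. ereal (- M) \<le> lower (f x) \<and> upper (f x) \<le> ereal M"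
    by (fastforce simp: f abs_le_iff)
  moreover have "lsc_hull X (\<lambda>y. upper (f y)) x = ereal (\<phi> x)" if "x \<in> topspace X" for x
    using lsc_hull_continuous[OF \<phi>(1) that]
      lsc_hull_cong[of X "\<lambda>y. upper (f y)" "\<lambda>y. ereal (\<phi> y)" x] by (simp add: f)
  moreover have "usc_hull X (\<lambda>y. lower (f y)) x = ereal (\<phi> x)" if "x \<in> topspace X" for x
    using usc_hull_continuous[OF \<phi>(1) that]
      usc_hull_cong[of X "\<lambda>y. lower (f y)" "\<lambda>y. ereal (\<phi> y)" x] by (simp add: f)
  moreover have "f \<in> ivl_funs X" by (simp add: f ivl_funs_def)
  ultimately show "f \<in> H_b X"
    unfolding H_b_iff H_funs_def H_continuous_iff by (auto simp: f)
qed

section \<open>Order completeness and order density\<close>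

lemma is_lub_ivl_fun_poset_iff:
  assumes "A \<subseteq> P"
  shows "is_lub (ivl_fun_poset X P) h A \<longleftrightarrow> h \<in> P \<and> (\<forall>f\<in>A. ivl_fun_le X f h) \<and>
    (\<forall>g\<in>P. (\<forall>f\<in>A. ivl_fun_le X f g) \<longrightarrow> ivl_fun_le X h g)"
  using assms by (simp add: least_def Upper_def ivl_fun_poset_def) blast

lemma is_glb_ivl_fun_poset_iff:
  assumes "A \<subseteq> P"
  shows "is_glb (ivl_fun_poset X P) h A \<longleftrightarrow> h \<in> P \<and> (\<forall>f\<in>A. ivl_fun_le X h f) \<and>
    (\<forall>g\<in>P. (\<forall>f\<in>A. ivl_fun_le X g f) \<longrightarrow> ivl_fun_le X g h)"
  using assms by (simp add: greatest_def Lower_def ivl_fun_poset_def) blast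

text \<open>The set of lower bounds of a nonempty set is bounded above by the elements of that set, so
  conditional suprema suffice.\<close>

lemma dedekind_complete_if_suprema:
  assumes L: "partial_order L"
    and sup: "\<And>A. A \<subseteq> carrier L \<Longrightarrow> A \<noteq> {} \<Longrightarrow> Upper L A \<noteq> {} \<Longrightarrow> \<exists>s. is_lub L s A"
  shows "dedekind_complete L"
  unfolding dedekind_complete_def
proof (intro conjI allI impI L)
  fix A assume A: "A \<subseteq> carrier L \<and> A \<noteq> {} \<and> Lower L A \<noteq> {}"
  then have "A \<subseteq> Upper L (Lower L A)" by (auto simp: Upper_def Lower_def)
  then obtain i where "is_lub L i (Lower L A)"
    using sup[of "Lower L A"] A Lower_closed[of L A] by auto
  then have "is_glb L i A"
    using A \<open>A \<subseteq> Upper L (Lower L A)\<close>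
    by (auto simp: least_def greatest_def Upper_def Lower_def)
  then show "\<exists>i. is_glb L i A" ..
qed (use sup in blast)

lemma dedekind_complete_H_b: "dedekind_complete (ivl_fun_poset X (H_b X))"
proof (rule dedekind_complete_if_suprema)
  show "partial_order (ivl_fun_poset X (H_b X))"
    by (rule partial_order_ivl_fun_poset) (auto simp: H_b_def H_funs_def H_continuous_def)
next
  fix A assume "A \<subseteq> carrier (ivl_fun_poset X (H_b X))" and ne: "A \<noteq> {}"
    and "Upper (ivl_fun_poset X (H_b X)) A \<noteq> {}"
  then obtain u where A: "A \<subseteq> H_b X" and u: "u \<in> H_b X" "\<And>f. f \<in> A \<Longrightarrow> ivl_fun_le X f u"
    by (auto simp: ivl_fun_poset_def Upper_def)
  obtain h where h: "h \<in> H_funs X" "\<And>f. f \<in> A \<Longrightarrow> ivl_fun_le X f h"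
    "\<And>g. g \<in> H_funs X \<Longrightarrow> (\<And>f. f \<in> A \<Longrightarrow> ivl_fun_le X f g) \<Longrightarrow> ivl_fun_le X h g"
    using H_funs_supremum[of A X] A H_b_subset_H_funs by blast
  obtain f where "f \<in> A" using ne by blast
  then have "h \<in> H_b X"
    using H_b_between[of f X u h] A u h H_b_subset_H_funs by blast
  moreover have "ivl_fun_le X h g" if "g \<in> H_b X" "\<forall>f\<in>A. ivl_fun_le X f g" for g
    using h(3)[of g] that H_b_subset_H_funs by blast
  ultimately have "is_lub (ivl_fun_poset X (H_b X)) h A"
    using h(2) by (simp add: is_lub_ivl_fun_poset_iff[OF A])
  then show "\<exists>s. is_lub (ivl_fun_poset X (H_b X)) s A" by blast
qed

lemma H_b_is_lub_C_b:
  assumes X: "completely_regular_space X" and q: "q \<in> H_b X"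
  shows "is_lub (ivl_fun_poset X (H_b X)) q {f \<in> C_b X. ivl_fun_le X f q}"
proof -
  have qH: "q \<in> H_funs X" using q H_b_subset_H_funs by blast
  obtain M :: real where M: "\<forall>x\<in>topspace X. ereal (- M) \<le> lower (q x)"
    using q by (auto simp: H_b_iff)
  have "ivl_fun_le X q g"
    if g: "g \<in> H_b X" and ub: "\<And>f. f \<in> C_b X \<Longrightarrow> ivl_fun_le X f q \<Longrightarrow> ivl_fun_le X f g" for g
  proof -
    have "lower (q x) \<le> lower (g x)" if x: "x \<in> topspace X" for x
    proof (rule dense_le)
      fix t assume t: "t < lower (q x)"
      show "t \<le> lower (g x)"
      proof (cases t)
        case (real r)
        have "ereal r < lsc_hull X (\<lambda>y. lower (q y)) x"
          using t real qH x by (simp add: H_funs_lower_lsc)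
        then obtain \<phi> where \<phi>: "continuous_map X euclideanreal \<phi>" "bounded (\<phi> ` topspace X)"
          "r \<le> \<phi> x" "\<forall>y\<in>topspace X. ereal (\<phi> y) \<le> lower (q y)"
          by (rule continuous_minorant[OF X x M])
        let ?f = "\<lambda>x\<in>topspace X. interval_of (ereal (\<phi> x))"
        have f: "?f \<in> C_b X" using \<phi> by (intro C_bI)
        then have "?f \<in> H_funs X" using C_b_subset_H_b H_b_subset_H_funs by blast
        then have "ivl_fun_le X ?f q" using \<phi>(4) qH by (simp add: ivl_fun_le_iff_lower)
        then have "ivl_fun_le X ?f g" using ub f by blast
        then have "ereal (\<phi> x) \<le> lower (g x)"
          using x by (auto simp: ivl_fun_le_def ivl_le_def)
        then show ?thesis using \<phi>(3) real by (metis ereal_less_eq(3) order_trans)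
      qed (use t in auto)
    qed
    moreover have "g \<in> H_funs X" using g H_b_subset_H_funs by blast
    ultimately show ?thesis using qH by (simp add: ivl_fun_le_iff_lower)
  qed
  moreover have "{f \<in> C_b X. ivl_fun_le X f q} \<subseteq> H_b X" using C_b_subset_H_b by blast
  ultimately show ?thesis using q by (simp add: is_lub_ivl_fun_poset_iff)
qed

text \<open>Negation turns upper bounds into lower semicontinuous functions: the continuous functions
  above \<open>q\<close> are the negatives of continuous minorants of \<open>- upper q\<close>.\<close>

lemma H_b_is_glb_C_b:
  assumes X: "completely_regular_space X" and q: "q \<in> H_b X"
  shows "is_glb (ivl_fun_poset X (H_b X)) q {f \<in> C_b X. ivl_fun_le X q f}"
proof -
  have qH: "q \<in> H_funs X" using q H_b_subset_H_funs by blast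
  obtain M :: real where "\<forall>x\<in>topspace X. upper (q x) \<le> ereal M"
    using q by (auto simp: H_b_iff)
  then have M: "\<forall>x\<in>topspace X. ereal (- M) \<le> - upper (q x)"
    by (simp flip: uminus_ereal.simps(1))
  have "ivl_fun_le X g q"
    if g: "g \<in> H_b X" and lb: "\<And>f. f \<in> C_b X \<Longrightarrow> ivl_fun_le X q f \<Longrightarrow> ivl_fun_le X g f" for g
  proof -
    have "upper (g x) \<le> upper (q x)" if x: "x \<in> topspace X" for x
    proof (rule dense_ge)
      fix t assume t: "upper (q x) < t"
      show "upper (g x) \<le> t"
      proof (cases t)
        case (real r)
        have "ereal (- r) < lsc_hull X (\<lambda>y. - upper (q y)) x"
          using t real qH x
          by (simp add: lsc_hull_uminus H_funs_upper_usc flip: uminus_ereal.simps(1))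
        then obtain \<phi> where \<phi>: "continuous_map X euclideanreal \<phi>" "bounded (\<phi> ` topspace X)"
          "- r \<le> \<phi> x" "\<forall>y\<in>topspace X. ereal (\<phi> y) \<le> - upper (q y)"
          by (rule continuous_minorant[OF X x M])
        let ?f = "\<lambda>x\<in>topspace X. interval_of (ereal (- \<phi> x))"
        have "bounded ((\<lambda>x. - \<phi> x) ` topspace X)"
          using \<phi>(2) by (simp add: bounded_iff)
        then have f: "?f \<in> C_b X" using \<phi>(1) by (intro C_bI) (auto intro: continuous_intros)
        then have "?f \<in> H_funs X" using C_b_subset_H_b H_b_subset_H_funs by blast
        moreover have "upper (q y) \<le> ereal (- \<phi> y)" if "y \<in> topspace X" for y
          using bspec[OF \<phi>(4) that] ereal_minus_le_minus[of "- upper (q y)" "ereal (\<phi> y)"] by simp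
        ultimately have "ivl_fun_le X q ?f" using qH by (simp add: ivl_fun_le_iff_upper)
        then have "ivl_fun_le X g ?f" using lb f by blast
        then have "upper (g x) \<le> ereal (- \<phi> x)"
          using x by (auto simp: ivl_fun_le_def ivl_le_def)
        also have "\<dots> \<le> t" using \<phi>(3) real by simp
        finally show ?thesis .
      qed (use t in auto)
    qed
    moreover have "g \<in> H_funs X" using g H_b_subset_H_funs by blast
    ultimately show ?thesis using qH by (simp add: ivl_fun_le_iff_upper)
  qed
  moreover have "{f \<in> C_b X. ivl_fun_le X q f} \<subseteq> H_b X" using C_b_subset_H_b by blast
  ultimately show ?thesis using q by (simp add: is_glb_ivl_fun_poset_iff)
qed

theorem mainTheorem3:
  fixes X :: "'a topology"
  assumes "completely_regular_space X"
  shows "dedekind_completion (C_b X) (ivl_fun_poset X (H_b X)) \<and> H_b X \<subseteq> H_ft X"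
proof
  have "carrier (ivl_fun_poset X (H_b X)) = H_b X" by (simp add: ivl_fun_poset_def)
  moreover have "\<exists>A\<subseteq>C_b X. is_lub (ivl_fun_poset X (H_b X)) q A" if "q \<in> H_b X" for q
    by (rule exI, rule conjI[OF _ H_b_is_lub_C_b[OF assms that]]) blast
  moreover have "\<exists>B\<subseteq>C_b X. is_glb (ivl_fun_poset X (H_b X)) q B" if "q \<in> H_b X" for q
    by (rule exI, rule conjI[OF _ H_b_is_glb_C_b[OF assms that]]) blast
  ultimately show "dedekind_completion (C_b X) (ivl_fun_poset X (H_b X))"
    unfolding dedekind_completion_def
    using C_b_subset_H_b[of X] dedekind_complete_H_b[of X] by simp
  show "H_b X \<subseteq> H_ft X" by (rule H_b_subset_H_ft)
qed

end
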